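(* Let $p$ be an odd prime and $n \ge 2p+1$ an integer. A $2p$-valent circulant $\mathrm{Cay}(\mathbb{Z}_n, S)$ with $[1] \in S$ is a first kind Frobenius graph with cyclic kernel $\mathbb{Z}_n$ if and only if $n \equiv 1 \pmod{2p}$ and $S = \langle [a]\rangle$ (the cyclic subgroup of $\mathbb{Z}_n^*$ generated by $[a]$) for some positive integer $a$ such that $a^p + 1 \equiv 0 \pmod n$ and $\gcd(a^i \pm 1, n) = 1$ for $1 \le i \le p-1$. Moreover, in this case $\mathrm{Cay}(\mathbb{Z}_n, \langle [a]\rangle)$ is a $\mathbb{Z}_n \rtimes \langle [a]\rangle$-arc-transitive first kind $\mathbb{Z}_n \rtimes \langle [a]\rangle$-Frobenius circulant.
   Context: $\mathrm{Cay}(\mathbb{Z}_n, S)$, for $[0]\notin S = -S$, is the circulant with vertex set $\mathbb{Z}_n$ and $x,y$ adjacent iff $x-y\in S$; its valency is $|S|$. A transitive permutation group is a Frobenius group if it is not regular and only the identity fixes two points. For a subgroup $H \le \mathbb{Z}_n^*$, $\mathbb{Z}_n \rtimes H$ acts on $\mathbb{Z}_n$ by $x \mapsto (x + b)h$. The circulant $\mathrm{Cay}(\mathbb{Z}_n, S)$ is a first kind $G$-Frobenius graph with kernel $\mathbb{Z}_n$, where $G = \mathbb{Z}_n \rtimes H$ with $H \le \mathbb{Z}_n^*$, if $G$ is a Frobenius group (with Frobenius kernel $\mathbb{Z}_n$) and $S = sH := \{sh : h \in H\}$ for some $s \in \mathbb{Z}_n$ with $\langle S\rangle = \mathbb{Z}_n$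 as an additive group, and either $|H|$ is even or $s$ has additive order $2$. "First kind Frobenius graph with cyclic kernel" means this holds for some such $H$. A graph is $G$-arc-transitive if $G$ acts as automorphisms transitively on ordered pairs of adjacent vertices. *)

theory Defs
  imports
    "HOL-Number_Theory.Residues"
    "HOL-Algebra.Generated_Groups"
    "HOL-Algebra.Group_Action"
    "Graph_Theory.Pair_Digraph"
begin

section \<open>Permutation groups\<close>

text \<open>
  A permutation group on \<open>X\<close> is a subgroup \<open>G\<close> of \<open>BijGroup X\<close>, acting on \<open>X\<close> by evaluation.
  The elements of \<open>BijGroup X\<close> are extensional, so they are determined by their values on \<open>X\<close>.
\<close>

definition transitive_perm_group :: "'a set \<Rightarrow> ('a \<Rightarrow> 'a) set \<Rightarrow> bool" where
  "transitive_perm_group X G \<longleftrightarrow>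
     subgroup G (BijGroup X) \<and> transitive_action ((BijGroup X)\<lparr>carrier := G\<rparr>) X (\<lambda>g. g)"

definition regular_perm_group :: "'a set \<Rightarrow> ('a \<Rightarrow> 'a) set \<Rightarrow> bool" where
  "regular_perm_group X G \<longleftrightarrow>
     transitive_perm_group X G \<and>
     (\<forall>x\<in>X. stabilizer ((BijGroup X)\<lparr>carrier := G\<rparr>) (\<lambda>g. g) x = {\<one>\<^bsub>BijGroup X\<^esub>})"

definition frobenius_group :: "'a set \<Rightarrow> ('a \<Rightarrow> 'a) set \<Rightarrow> bool" where
  "frobenius_group X G \<longleftrightarrow>
     transitive_perm_group X G \<and> \<not> regular_perm_group X G \<and>
     (\<forall>g\<in>G. \<forall>x\<in>X. \<forall>y\<in>X. x \<noteq> y \<and> g x = x \<and> g y = y \<longrightarrow> g = \<one>\<^bsub>BijGroup X\<^esub>)"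

definition frobenius_kernel :: "'a set \<Rightarrow> ('a \<Rightarrow> 'a) set \<Rightarrow> ('a \<Rightarrow> 'a) set" where
  "frobenius_kernel X G = {\<one>\<^bsub>BijGroup X\<^esub>} \<union> {g \<in> G. \<forall>x\<in>X. g x \<noteq> x}"

section \<open>The groups \<open>\<int>\<^sub>n \<rtimes> H\<close>\<close>

text \<open>
  \<open>\<int>\<^sub>n\<close> is the ring \<open>residue_ring n\<close> on \<open>{0..n - 1}\<close>, so the class \<open>[a]\<close> is \<open>a mod n\<close>, and
  \<open>\<int>\<^sub>n\<^sup>*\<close> is \<open>units_of (residue_ring n)\<close>.
\<close>

definition affine_perm :: "int \<Rightarrow> int \<Rightarrow> int \<Rightarrow> int \<Rightarrow> int" where
  "affine_perm n b h =
     (\<lambda>x \<in> carrier (residue_ring n). (x \<oplus>\<^bsub>residue_ring n\<^esub> b) \<otimes>\<^bsub>residue_ring n\<^esub> h)"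

text \<open>
  The action of \<open>\<int>\<^sub>n \<rtimes> H\<close> on \<open>\<int>\<^sub>n\<close> is faithful, so the group is taken to be its image in the
  symmetric group on \<open>\<int>\<^sub>n\<close>. In particular the copy of \<open>\<int>\<^sub>n\<close> inside it, consisting of the
  translations, is the case \<open>H = {1}\<close>.
\<close>

definition affine_group :: "int \<Rightarrow> int set \<Rightarrow> (int \<Rightarrow> int) set" where
  "affine_group n H = {affine_perm n b h | b h. b \<in> carrier (residue_ring n) \<and> h \<in> H}"

definition translation_group :: "int \<Rightarrow> (int \<Rightarrow> int) set" where
  "translation_group n = affine_group n {\<one>\<^bsub>residue_ring n\<^esub>}"

section \<open>Circulants\<close>

text \<open>A simple graph is represented by its symmetric, irreflexive set of arcs.\<close>

definition circulant_set :: "int \<Rightarrow> int set \<Rightarrow> bool" where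
  "circulant_set n S \<longleftrightarrow>
     S \<subseteq> carrier (residue_ring n) \<and> \<zero>\<^bsub>residue_ring n\<^esub> \<notin> S \<and>
     (\<lambda>x. \<ominus>\<^bsub>residue_ring n\<^esub> x) ` S = S"

definition circulant :: "int \<Rightarrow> int set \<Rightarrow> int pair_pre_digraph" where
  "circulant n S =
     \<lparr>pverts = carrier (residue_ring n),
      parcs = {(x, y). x \<in> carrier (residue_ring n) \<and> y \<in> carrier (residue_ring n) \<and>
                       x \<ominus>\<^bsub>residue_ring n\<^esub> y \<in> S}\<rparr>"

definition arc_transitive :: "('a \<Rightarrow> 'a) set \<Rightarrow> 'a pair_pre_digraph \<Rightarrow> bool" where
  "arc_transitive G \<Gamma> \<longleftrightarrow>
     subgroup G (BijGroup (pverts \<Gamma>)) \<and>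
     (\<forall>g\<in>G. \<forall>x\<in>pverts \<Gamma>. \<forall>y\<in>pverts \<Gamma>. (x, y) \<in> parcs \<Gamma> \<longleftrightarrow> (g x, g y) \<in> parcs \<Gamma>) \<and>
     (\<forall>(x, y)\<in>parcs \<Gamma>. \<forall>(u, v)\<in>parcs \<Gamma>. \<exists>g\<in>G. g x = u \<and> g y = v)"

section \<open>First kind Frobenius graphs with cyclic kernel\<close>

text \<open>
  \<open>first_kind_frobenius_with n H \<Gamma>\<close> means that \<open>\<Gamma>\<close> is a first kind \<open>G\<close>-Frobenius graph with
  kernel \<open>\<int>\<^sub>n\<close>, where \<open>G = \<int>\<^sub>n \<rtimes> H\<close>. The connection set \<open>S = sH\<close> is the left coset
  \<open>s <# H\<close> formed in the multiplicative monoid of \<open>\<int>\<^sub>n\<close>, as \<open>s\<close> need not be a unit.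
\<close>

definition first_kind_frobenius_with :: "int \<Rightarrow> int set \<Rightarrow> int pair_pre_digraph \<Rightarrow> bool" where
  "first_kind_frobenius_with n H \<Gamma> \<longleftrightarrow>
     subgroup H (units_of (residue_ring n)) \<and>
     frobenius_group (carrier (residue_ring n)) (affine_group n H) \<and>
     frobenius_kernel (carrier (residue_ring n)) (affine_group n H) = translation_group n \<and>
     (\<exists>S. \<exists>s \<in> carrier (residue_ring n).
        S = s <#\<^bsub>residue_ring n\<^esub> H \<and>
        circulant_set n S \<and> \<Gamma> = circulant n S \<and>
        generate (add_monoid (residue_ring n)) S = carrier (residue_ring n) \<and>
        (even (card H) \<or> group.ord (add_monoid (residue_ring n)) s = 2))"

definition first_kind_frobenius :: "int \<Rightarrow> int pair_pre_digraph \<Rightarrow> bool" where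
  "first_kind_frobenius n \<Gamma> \<longleftrightarrow> (\<exists>H. first_kind_frobenius_with n H \<Gamma>)"

end

theory Submission
  imports Defs "HOL-Number_Theory.Number_Theory"
begin

text \<open>
  The group \<open>\<int>\<^sub>n \<rtimes> H\<close> is a Frobenius group with kernel \<open>\<int>\<^sub>n\<close> iff \<open>H \<noteq> 1\<close> and \<open>h - 1\<close> is a
  unit for every \<open>h \<in> H - {1}\<close>, since the fixed points of \<open>x \<mapsto> (x + b) h\<close> are the solutions of
  \<open>x (h - 1) = - b h\<close>. If \<open>1 \<in> S = s H\<close>, then \<open>S = H\<close>, so \<open>-1 \<in> H\<close> and \<open>H\<close> has order \<open>2 p\<close>. As
  \<open>z - 1\<close> is a unit for all \<open>z \<in> H - {1}\<close>, the only square roots of \<open>1\<close> in \<open>H\<close> are \<open>1\<close> and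
  \<open>-1\<close>; for any other \<open>h \<in> H\<close> either \<open>h\<^sup>p = -1\<close> or \<open>(-h)\<^sup>p = -1\<close>, which yields a generator \<open>a\<close>.
  Modulo every prime \<open>q\<close> dividing \<open>n\<close>, \<open>a\<close> still has order \<open>2 p\<close>, so \<open>q \<equiv> 1\<close> and hence
  \<open>n \<equiv> 1 (mod 2 p)\<close>.
\<close>

section \<open>Congruences modulo twice a prime\<close>

lemma cong_1_of_prime_divisors:
  fixes n k :: nat
  assumes "n > 0" and "\<And>q. prime q \<Longrightarrow> q dvd n \<Longrightarrow> [q = 1] (mod k)"
  shows "[n = 1] (mod k)"
  using assms
proof (induction n rule: prime_divisors_induct)
  case (factor q n)
  have "[n = 1] (mod k)"
    using factor by auto
  moreover have "[q = 1] (mod k)"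
    using factor by auto
  ultimately show ?case
    using cong_mult by fastforce
qed auto

text \<open>Serves to pin down the order of an element. Were \<open>d\<close> coprime to
  \<open>p\<close>, it would divide 2; so \<open>d = p * k\<close> with \<open>k\<close> dividing 2,
  and \<open>k = 1\<close> is excluded because \<open>d\<close> does not divide
  \<open>p\<close>.\<close>

lemma dvd_twice_prime_eq:
  fixes p d :: nat
  assumes p: "prime p" and d: "d dvd 2 * p" "\<not> d dvd 2" "\<not> d dvd p"
  shows "d = 2 * p"
proof -
  have "p dvd d"
    using p d(1,2) by (metis coprime_commute coprime_dvd_mult_left_iff prime_imp_coprime)
  then obtain k where k: "d = p * k" ..
  have "p > 0"
    using p prime_gt_0_nat by blast
  have "k dvd 2"
    using d(1) k \<open>p > 0\<close> by (simp add: mult.commute[of 2])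
  then have "k = 1 \<or> k = 2"
    by (metis prime_nat_iff two_is_prime_nat)
  then show ?thesis
    using k d(3) by auto
qed

text \<open>At each prime \<open>q\<close> dividing \<open>n\<close>, the order of \<open>a\<close>
  divides \<open>2 * p\<close>. It does not divide 2, because \<open>q\<close> divides neither
  \<open>a - 1\<close> nor \<open>a + 1\<close>, and it does not divide \<open>p\<close>, because
  \<open>1\<close> and \<open>-1\<close> differ modulo the odd \<open>q\<close>. Hence it equals
  \<open>2 * p\<close>, which therefore divides \<open>q - 1\<close>.\<close>

lemma cong_1_mod_twice_prime:
  fixes p :: nat and n a :: int
  assumes p: "prime p" and n: "n > 0" "odd n"
    and a: "a \<ge> 0" "[a ^ p = - 1] (mod n)" "coprime (a - 1) n" "coprime (a + 1) n"
  shows "[n = 1] (mod (2 * int p))"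
proof -
  \<comment> \<open>The order \<open>ord\<close> is taken over natural numbers, whence the copy
    \<open>b\<close> of \<open>a\<close>.\<close>
  define b where "b = nat a"
  have ab: "a = int b"
    using a by (simp add: b_def)
  have "[nat n = 1] (mod (2 * p))"
  proof (rule cong_1_of_prime_divisors)
    show "nat n > 0"
      using n by simp
    fix q :: nat assume q: "prime q" "q dvd nat n"
    then have qn: "int q dvd n"
      using n by (simp add: int_dvd_int_iff[symmetric])
    have ap: "[a ^ p = - 1] (mod int q)"
      using a(2) qn by (rule cong_dvd_modulus)
    have not_unit: "\<not> is_unit (int q)"
      using prime_gt_1_nat[OF q(1)] by simp
    have "\<not> int q dvd 2"
    proof
      assume "int q dvd 2"
      then have "q dvd 2"
        by (metis int_dvd_int_iff of_nat_numeral)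
      then have "q = 2"
        using q(1) primes_dvd_imp_eq two_is_prime_nat by blast
      then show False
        using qn n(2) by simp
    qed
    have not_dvd: "\<not> int q dvd a - 1" "\<not> int q dvd a + 1"
      using a(3,4) qn not_unit by (meson coprime_common_divisor)+
    have pow: "[b ^ k = 1] (mod q) \<longleftrightarrow> int q dvd a ^ k - 1" for k
      by (simp add: ab cong_int_iff[symmetric] cong_iff_dvd_diff)
    have "int q dvd (a ^ p + 1) * (a ^ p - 1)"
      using ap by (simp add: cong_iff_dvd_diff)
    then have "[b ^ (2 * p) = 1] (mod q)"
      unfolding pow by (simp add: algebra_simps power_mult power2_eq_square mult_2 power_add)
    then have 1: "ord q b dvd 2 * p"
      using ord_divides by blast
    have "prime (int q)"
      using q by simp
    then have "\<not> int q dvd (a - 1) * (a + 1)"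
      using not_dvd prime_dvd_mult_iff by blast
    then have "\<not> [b ^ 2 = 1] (mod q)"
      unfolding pow by (simp add: algebra_simps power2_eq_square)
    then have 2: "\<not> ord q b dvd 2"
      using ord_divides by blast
    have "\<not> [b ^ p = 1] (mod q)"
    proof
      assume "[b ^ p = 1] (mod q)"
      then have "int q dvd a ^ p - 1" "int q dvd a ^ p + 1"
        using pow ap by (auto simp: cong_iff_dvd_diff)
      then have "int q dvd (a ^ p + 1) - (a ^ p - 1)"
        by (rule dvd_diff[rotated])
      with \<open>\<not> int q dvd 2\<close> show False
        by simp
    qed
    then have 3: "\<not> ord q b dvd p"
      using ord_divides by blast
    have eq: "ord q b = 2 * p"
      by (rule dvd_twice_prime_eq[OF p 1 2 3])
    \<comment> \<open>\<open>ord\<close> takes the default value 0 on arguments that are not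
      coprime, so a nonzero order yields coprimality.\<close>
    then have "coprime q b"
      by (metis ord_not_coprime mult_eq_0_iff not_prime_0 p zero_neq_numeral)
    then have "2 * p dvd q - 1"
      using order_divides_totient[of q b] eq q(1) by (simp add: totient_prime)
    then show "[q = 1] (mod (2 * p))"
      using prime_ge_1_nat[OF q(1)] cong_altdef_nat by blast
  qed
  then show ?thesis
    using n by (simp add: cong_int_iff[symmetric])
qed

section \<open>Subgroups of the group of units in integer terms\<close>

context residues
begin

text \<open>The interface through which later arguments see a group of units: reduced integers,
  congruences and coprimality instead of the operations of \<open>units_of R\<close>.\<close>

lemma units_subgroupD:
  assumes "subgroup H (units_of R)"
  shows "1 \<in> H"
    and "h \<in> H \<Longrightarrow> 0 < h" and "h \<in> H \<Longrightarrow> h < m" and "h \<in> H \<Longrightarrow> coprime h m"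
    and "h \<in> H \<Longrightarrow> k \<in> H \<Longrightarrow> (h * k) mod m \<in> H"
    and "h \<in> H \<Longrightarrow> \<exists>k\<in>H. [h * k = 1] (mod m)"
proof -
  interpret U: group "units_of R"
    by (rule units_group)
  show "1 \<in> H"
    using subgroup.one_closed[OF assms] by (simp add: units_of_one res_one_eq)
  have "H \<subseteq> Units R"
    using subgroup.subset[OF assms] by (simp add: units_of_carrier)
  then show "h \<in> H \<Longrightarrow> 0 < h" "h \<in> H \<Longrightarrow> h < m" "h \<in> H \<Longrightarrow> coprime h m"
    by (auto simp: res_units_eq)
  show "h \<in> H \<Longrightarrow> k \<in> H \<Longrightarrow> (h * k) mod m \<in> H"
    using subgroup.m_closed[OF assms, of h k] by (simp add: units_of_mult res_mult_eq)
  assume h: "h \<in> H"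
  then have "h \<in> carrier (units_of R)"
    using \<open>H \<subseteq> Units R\<close> by (auto simp: units_of_carrier)
  then have "(h * inv\<^bsub>units_of R\<^esub> h) mod m = 1"
    using U.r_inv[of h] by (simp add: units_of_one units_of_mult res_mult_eq res_one_eq)
  moreover have "inv\<^bsub>units_of R\<^esub> h \<in> H"
    using assms h by (rule subgroup.m_inv_closed)
  ultimately show "\<exists>k\<in>H. [h * k = 1] (mod m)"
    using m_gt_one by (auto simp: cong_def)
qed

lemma units_subgroup_power:
  assumes "subgroup H (units_of R)" "h \<in> H"
  shows "h ^ k mod m \<in> H"
proof (induction k)
  case 0
  then show ?case
    using units_subgroupD(1)[OF assms(1)] m_gt_one by simp
next
  case (Suc k)
  then have "(h * (h ^ k mod m)) mod m \<in> H"
    using units_subgroupD(5)[OF assms(1)] assms(2) by blast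
  then show ?case
    by (simp add: mod_mult_right_eq)
qed

text \<open>Lagrange's theorem, applied inside the group whose carrier is \<open>H\<close> itself
  and whose order is \<open>card H\<close>.\<close>

lemma units_subgroup_power_card:
  assumes H: "subgroup H (units_of R)" and "h \<in> H"
  shows "[h ^ card H = 1] (mod m)"
proof -
  interpret U: group "units_of R"
    by (rule units_group)
  interpret K: group "(units_of R)\<lparr>carrier := H\<rparr>"
    using H by (rule U.subgroup_imp_group)
  have h: "h \<in> Units R" "0 < h" "h < m"
    using assms units_subgroupD[OF H] by (auto simp: res_units_eq)
  have "h [^]\<^bsub>(units_of R)\<lparr>carrier := H\<rparr>\<^esub> order ((units_of R)\<lparr>carrier := H\<rparr>) = 1"
    using K.pow_order_eq_1[of h] assms(2) by (simp add: units_of_one res_one_eq)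
  then have "h [^]\<^bsub>units_of R\<^esub> card H = 1"
    by (simp add: order_def U.nat_pow_consistent[symmetric])
  then have "h [^] card H = 1"
    using units_of_pow[OF h(1)] by simp
  then show ?thesis
    using pow_cong[of h "card H"] h m_gt_one by (simp add: cong_def)
qed

section \<open>Affine permutations and the group they form\<close>

lemma affine_perm_apply:
  "x \<in> carrier R \<Longrightarrow> affine_perm m b h x = ((x + b) * h) mod m"
  unfolding affine_perm_def R_m_def[symmetric] by (simp add: res_add_eq res_mult_eq mod_simps)

lemma affine_perm_extensional: "affine_perm m b h \<in> extensional (carrier R)"
  unfolding affine_perm_def R_m_def[symmetric] by simp

lemma affine_perm_eqI:
  assumes "f \<in> extensional (carrier R)"
    and "\<And>x. x \<in> carrier R \<Longrightarrow> f x = ((x + b) * h) mod m"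
  shows "f = affine_perm m b h"
  using assms affine_perm_extensional by (intro extensionalityI[where A = "carrier R"]) (auto simp: affine_perm_apply)

text \<open>The factor \<open>h\<close> cancels modulo \<open>m\<close>, which gives injectivity; on
  a finite carrier an injective self-map is onto.\<close>

lemma affine_perm_Bij:
  assumes "coprime h m"
  shows "affine_perm m b h \<in> Bij (carrier R)"
proof -
  have "inj_on (affine_perm m b h) (carrier R)"
  proof (rule inj_onI)
    fix x y assume xy: "x \<in> carrier R" "y \<in> carrier R" "affine_perm m b h x = affine_perm m b h y"
    then have "[(x + b) * h = (y + b) * h] (mod m)"
      by (simp add: affine_perm_apply cong_def)
    then have "[x = y] (mod m)"
      using assms by (simp add: cong_mult_rcancel cong_add_rcancel coprime_commute)
    then show "x = y"
      using xy by (auto simp: cong_def res_carrier_eq)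
  qed
  moreover have "affine_perm m b h ` carrier R \<subseteq> carrier R"
    by (auto simp: affine_perm_apply)
  ultimately have "bij_betw (affine_perm m b h) (carrier R) (carrier R)"
    by (simp add: bij_betw_def endo_inj_surj)
  then show ?thesis
    by (simp add: Bij_def affine_perm_extensional)
qed

lemma one_BijGroup_eq_affine_perm: "\<one>\<^bsub>BijGroup (carrier R)\<^esub> = affine_perm m 0 1"
  by (rule affine_perm_eqI) (auto simp: BijGroup_def res_carrier_eq)

text \<open>Two values determine the map: the one at 0 makes \<open>b * h\<close> vanish, after
  which the one at 1 reads off \<open>h\<close>.\<close>

lemma affine_perm_eq_one_iff:
  assumes "b \<in> carrier R" "h \<in> carrier R"
  shows "affine_perm m b h = \<one>\<^bsub>BijGroup (carrier R)\<^esub> \<longleftrightarrow> b = 0 \<and> h = 1"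
proof
  assume "affine_perm m b h = \<one>\<^bsub>BijGroup (carrier R)\<^esub>"
  then have *: "affine_perm m b h x = affine_perm m 0 1 x" for x
    by (simp add: one_BijGroup_eq_affine_perm)
  have b: "(b * h) mod m = 0" "((1 + b) * h) mod m = 1"
    using *[of 0] *[of 1] m_gt_one by (auto simp: affine_perm_apply res_carrier_eq)
  then have "m dvd b * h"
    by auto
  then have "((1 + b) * h) mod m = h mod m"
    by (simp add: algebra_simps mod_eq_dvd_iff)
  then have h: "h = 1"
    using b assms by (simp add: res_carrier_eq)
  with b assms show "b = 0 \<and> h = 1"
    by (simp add: res_carrier_eq)
qed (simp add: one_BijGroup_eq_affine_perm)

text \<open>The right factor acts first. As \<open>affine_perm\<close> translates before it
  multiplies, \<open>b\<close> has to be pulled back through \<open>h'\<close>; this is why an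
  inverse \<open>k\<close> of \<open>h'\<close> occurs in the translation part.\<close>

lemma compose_affine_perm:
  assumes "coprime h m" "coprime h' m" "[h' * k = 1] (mod m)"
  shows "affine_perm m b h \<otimes>\<^bsub>BijGroup (carrier R)\<^esub> affine_perm m b' h' =
         affine_perm m ((b' + b * k) mod m) ((h' * h) mod m)"
proof -
  have "affine_perm m b h \<otimes>\<^bsub>BijGroup (carrier R)\<^esub> affine_perm m b' h' =
        compose (carrier R) (affine_perm m b h) (affine_perm m b' h')"
    using assms by (simp add: BijGroup_def affine_perm_Bij)
  also have "\<dots> = affine_perm m ((b' + b * k) mod m) ((h' * h) mod m)"
  proof (rule affine_perm_eqI)
    fix x assume x: "x \<in> carrier R"
    have "[b * (h' * k) = b * 1] (mod m)"
      using assms(3) by (rule cong_scalar_left)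
    then have "[((x + b') * h' + b) * h = ((x + b') * h' + b * (h' * k)) * h] (mod m)"
      by (intro cong_scalar_right cong_add) (auto simp: cong_sym_eq)
    then have "[((x + b') * h' + b) * h = (x + (b' + b * k)) * (h' * h)] (mod m)"
      by (simp add: algebra_simps)
    moreover have "[(((x + b') * h') mod m + b) * h = ((x + b') * h' + b) * h] (mod m)"
      by (intro cong_mult cong_add) auto
    moreover have "[(x + (b' + b * k)) * (h' * h) = (x + (b' + b * k) mod m) * ((h' * h) mod m)] (mod m)"
      by (intro cong_mult cong_add) (auto simp: cong_def)
    ultimately have "[(((x + b') * h') mod m + b) * h =
        (x + (b' + b * k) mod m) * ((h' * h) mod m)] (mod m)"
      using cong_trans by blast
    then show "compose (carrier R) (affine_perm m b h) (affine_perm m b' h') x =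
               ((x + (b' + b * k) mod m) * ((h' * h) mod m)) mod m"
      using x by (simp add: compose_eq affine_perm_apply cong_def)
  qed auto
  finally show ?thesis .
qed

lemma affine_groupE:
  assumes "g \<in> affine_group m H"
  obtains b h where "g = affine_perm m b h" "b \<in> carrier R" "h \<in> H"
  using assms unfolding affine_group_def R_m_def[symmetric] by blast

lemma affine_groupI:
  "b \<in> carrier R \<Longrightarrow> h \<in> H \<Longrightarrow> affine_perm m b h \<in> affine_group m H"
  unfolding affine_group_def R_m_def[symmetric] by blast

lemma subgroup_affine_group:
  assumes H: "subgroup H (units_of R)"
  shows "subgroup (affine_group m H) (BijGroup (carrier R))"
proof -
  interpret B: group "BijGroup (carrier R)"
    by (rule group_BijGroup)
  note HD = units_subgroupD[OF H]
  show ?thesis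
  proof (rule B.subgroupI)
    show sub: "affine_group m H \<subseteq> carrier (BijGroup (carrier R))"
      by (auto elim!: affine_groupE simp: BijGroup_def affine_perm_Bij HD)
    show "affine_group m H \<noteq> {}"
      using affine_groupI[of 0 1 H] HD(1) m_gt_one by (auto simp: res_carrier_eq)
    show "f \<otimes>\<^bsub>BijGroup (carrier R)\<^esub> g \<in> affine_group m H"
      if fg: "f \<in> affine_group m H" "g \<in> affine_group m H" for f g
    proof -
      obtain b h b' h' where "f = affine_perm m b h" "h \<in> H" "g = affine_perm m b' h'" "h' \<in> H"
        using fg by (metis affine_groupE)
      moreover obtain k where "[h' * k = 1] (mod m)"
        using HD(6) \<open>h' \<in> H\<close> by blast
      ultimately show ?thesis
        by (simp add: compose_affine_perm HD affine_groupI)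
    qed
    show "inv\<^bsub>BijGroup (carrier R)\<^esub> g \<in> affine_group m H" if g: "g \<in> affine_group m H" for g
    proof -
      obtain b h where bh: "g = affine_perm m b h" "h \<in> H"
        using g by (metis affine_groupE)
      obtain k where k: "k \<in> H" "[h * k = 1] (mod m)"
        using HD(6) bh(2) by blast
      \<comment> \<open>Solving \<open>y = (x + b) * h\<close> for \<open>x\<close> gives
        \<open>x = (y - b * h) * k\<close>, which is the inverse map in affine form.\<close>
      let ?f = "affine_perm m ((- (b * h)) mod m) k"
      have "[b * (h * k) = b * 1] (mod m)"
        using k(2) by (rule cong_scalar_left)
      then have "m dvd b * (h * k) - b"
        by (simp add: cong_iff_dvd_diff)
      then have "(b + - (b * h) mod m * k) mod m = 0"
        by (metis (no_types, lifting) add.commute add_uminus_conv_diff dvd_minus_iff minus_diff_eq mod_0_imp_dvd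
            dvd_imp_mod_0 mod_add_right_eq mod_mult_left_eq mult.assoc mult_minus_left)
      moreover have "(h * k) mod m = 1"
        using k(2) m_gt_one by (simp add: cong_def)
      ultimately have "?f \<otimes>\<^bsub>BijGroup (carrier R)\<^esub> g = \<one>\<^bsub>BijGroup (carrier R)\<^esub>"
        using bh k by (simp add: compose_affine_perm HD one_BijGroup_eq_affine_perm)
      moreover have f: "?f \<in> affine_group m H"
        using k(1) by (simp add: affine_groupI)
      ultimately have "inv\<^bsub>BijGroup (carrier R)\<^esub> g = ?f"
        using sub g by (intro B.inv_equality) auto
      then show ?thesis
        using f by simp
    qed
  qed
qed

lemma transitive_affine_group:
  assumes H: "subgroup H (units_of R)"
  shows "transitive_perm_group (carrier R) (affine_group m H)"
  unfolding transitive_perm_group_def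
proof (intro conjI subgroup_affine_group H)
  interpret B: group "BijGroup (carrier R)"
    by (rule group_BijGroup)
  let ?A = "(BijGroup (carrier R))\<lparr>carrier := affine_group m H\<rparr>"
  have sub: "subgroup (affine_group m H) (BijGroup (carrier R))"
    by (rule subgroup_affine_group[OF H])
  show "transitive_action ?A (carrier R) (\<lambda>g. g)"
  proof (intro transitive_action.intro group_action.intro transitive_action_axioms.intro)
    show "group_hom ?A (BijGroup (carrier R)) (\<lambda>g. g)"
      using sub B.subgroup_imp_group[OF sub] subgroup.subset[OF sub]
      by (auto simp: group_hom_def group_hom_axioms_def hom_def B.is_group)
    fix x y assume "x \<in> carrier R" "y \<in> carrier R"
    then have "affine_perm m ((y - x) mod m) 1 x = y"
      by (simp add: affine_perm_apply mod_simps res_carrier_eq)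
    moreover have "affine_perm m ((y - x) mod m) 1 \<in> affine_group m H"
      by (simp add: affine_groupI units_subgroupD(1)[OF H])
    ultimately show "\<exists>g\<in>carrier ?A. g x = y"
      by auto
  qed
qed

section \<open>Fixed points and the Frobenius property\<close>

lemma affine_perm_fixed_iff:
  assumes "x \<in> carrier R"
  shows "affine_perm m b h x = x \<longleftrightarrow> m dvd x * (h - 1) + b * h"
proof -
  have "affine_perm m b h x = x \<longleftrightarrow> ((x + b) * h) mod m = x mod m"
    using assms by (simp add: affine_perm_apply res_carrier_eq)
  also have "\<dots> \<longleftrightarrow> m dvd x * (h - 1) + b * h"
    by (simp add: mod_eq_dvd_iff algebra_simps)
  finally show ?thesis .
qed

text \<open>Subtracting the conditions for two fixed points \<open>x\<close> and \<open>y\<close>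
  gives \<open>m dvd (x - y) * (k - 1)\<close>. For distinct points \<open>k - 1\<close> is then no
  unit, so \<open>k = 1\<close>, and a translation with a fixed point is trivial. Multiplication by
  some \<open>h\<close> other than 1 fixes 0, so the group is not regular.\<close>

lemma frobenius_affine_group:
  assumes H: "subgroup H (units_of R)" and "H \<noteq> {1}"
    and semireg: "\<And>h. h \<in> H \<Longrightarrow> h \<noteq> 1 \<Longrightarrow> coprime (h - 1) m"
  shows "frobenius_group (carrier R) (affine_group m H)"
  unfolding frobenius_group_def
proof (intro conjI ballI impI)
  note HD = units_subgroupD[OF H]
  show "transitive_perm_group (carrier R) (affine_group m H)"
    by (rule transitive_affine_group[OF H])
  have 0: "0 \<in> carrier R"
    using m_gt_one by (simp add: res_carrier_eq)
  obtain h where h: "h \<in> H" "h \<noteq> 1"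
    using assms(2) HD(1) by blast
  then have hR: "h \<in> carrier R"
    using HD(2,3)[of h] by (simp add: res_carrier_eq)
  have "affine_perm m 0 h \<noteq> \<one>\<^bsub>BijGroup (carrier R)\<^esub>"
    using hR h(2) 0 by (simp add: affine_perm_eq_one_iff)
  moreover have "affine_perm m 0 h 0 = 0"
    using 0 by (simp add: affine_perm_apply)
  ultimately show "\<not> regular_perm_group (carrier R) (affine_group m H)"
    using affine_groupI[OF 0 h(1)] 0 unfolding regular_perm_group_def stabilizer_def by auto
  fix g x y assume g: "g \<in> affine_group m H" and xy: "x \<in> carrier R" "y \<in> carrier R"
    and fixed: "x \<noteq> y \<and> g x = x \<and> g y = y"
  obtain b k where k: "g = affine_perm m b k" "b \<in> carrier R" "k \<in> H"
    using g by (rule affine_groupE)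
  have dvd: "m dvd x * (k - 1) + b * k" "m dvd y * (k - 1) + b * k"
    using fixed xy k by (auto simp: affine_perm_fixed_iff)
  then have "m dvd (x * (k - 1) + b * k) - (y * (k - 1) + b * k)"
    by (rule dvd_diff)
  then have "m dvd (x - y) * (k - 1)"
    by (simp add: algebra_simps)
  moreover have "\<not> m dvd x - y"
    using xy fixed by (auto simp: res_carrier_eq mod_eq_dvd_iff[symmetric])
  ultimately have "\<not> coprime (k - 1) m"
    by (metis coprime_commute coprime_dvd_mult_left_iff)
  then have "k = 1"
    using semireg k by blast
  then have "b = 0"
    using dvd k by (simp add: res_carrier_eq mod_eq_0_iff_dvd[symmetric])
  then show "g = \<one>\<^bsub>BijGroup (carrier R)\<^esub>"
    using k \<open>k = 1\<close> by (simp add: one_BijGroup_eq_affine_perm)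
qed

text \<open>If \<open>h - 1\<close> is a unit, the linear congruence for a fixed point is solvable,
  so only translations can be free of fixed points; conversely a nonzero translation moves every
  point.\<close>

lemma frobenius_kernel_affine_group:
  assumes H: "subgroup H (units_of R)"
    and semireg: "\<And>h. h \<in> H \<Longrightarrow> h \<noteq> 1 \<Longrightarrow> coprime (h - 1) m"
  shows "frobenius_kernel (carrier R) (affine_group m H) = translation_group m"
proof -
  note HD = units_subgroupD[OF H]
  have trans: "translation_group m = affine_group m {1}"
    unfolding translation_group_def R_m_def[symmetric] by (simp add: res_one_eq)
  have 0: "0 \<in> carrier R"
    using m_gt_one by (simp add: res_carrier_eq)
  show ?thesis
    unfolding trans frobenius_kernel_def
  proof (intro equalityI subsetI)
    fix g assume g: "g \<in> {\<one>\<^bsub>BijGroup (carrier R)\<^esub>} \<union> {g \<in> affine_group m H. \<forall>x\<in>carrier R. g x \<noteq> x}"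
    show "g \<in> affine_group m {1}"
    proof (cases "g = \<one>\<^bsub>BijGroup (carrier R)\<^esub>")
      case True
      then show ?thesis
        using 0 by (simp add: one_BijGroup_eq_affine_perm affine_groupI)
    next
      case False
      then obtain b h where bh: "g = affine_perm m b h" "b \<in> carrier R" "h \<in> H"
        using g by (metis (no_types, lifting) UnE affine_groupE mem_Collect_eq singletonD)
      have "h = 1"
      proof (rule ccontr)
        assume "h \<noteq> 1"
        then have "coprime (h - 1) m"
          using semireg bh by blast
        then obtain u where u: "[(h - 1) * u = 1] (mod m)"
          using cong_solve_coprime_int by blast
        define x where "x = (- (b * h) * u) mod m"
        have "[(- (b * h)) * ((h - 1) * u) = - (b * h) * 1] (mod m)"
          using u by (rule cong_scalar_left)
        then have "[x * (h - 1) = - (b * h)] (mod m)"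
          by (simp add: x_def cong_def mod_simps mult_ac)
        then have "m dvd x * (h - 1) + b * h"
          by (simp add: cong_iff_dvd_diff)
        moreover have "x \<in> carrier R"
          by (simp add: x_def)
        ultimately show False
          using g False bh affine_perm_fixed_iff by auto
      qed
      then show ?thesis
        using bh by (simp add: affine_groupI)
    qed
  next
    fix g assume "g \<in> affine_group m {1}"
    then obtain b where b: "g = affine_perm m b 1" "b \<in> carrier R"
      by (metis affine_groupE singletonD)
    have "\<forall>x\<in>carrier R. g x \<noteq> x" if "b \<noteq> 0"
      using that b by (simp add: affine_perm_fixed_iff res_carrier_eq zdvd_not_zless)
    moreover have "g \<in> affine_group m H"
      using b HD(1) by (simp add: affine_groupI)
    moreover have "g = \<one>\<^bsub>BijGroup (carrier R)\<^esub>" if "b = 0"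
      using that b by (simp add: one_BijGroup_eq_affine_perm)
    ultimately show "g \<in> {\<one>\<^bsub>BijGroup (carrier R)\<^esub>} \<union> {g \<in> affine_group m H. \<forall>x\<in>carrier R. g x \<noteq> x}"
      by blast
  qed
qed

text \<open>If \<open>h - 1\<close> shares a factor \<open>d > 1\<close> with \<open>m\<close>, then \<open>x \<mapsto> x h\<close> fixes \<open>m / d\<close> besides \<open>0\<close>.\<close>

lemma frobenius_affine_groupD:
  assumes H: "subgroup H (units_of R)"
    and frob: "frobenius_group (carrier R) (affine_group m H)"
    and h: "h \<in> H" "h \<noteq> 1"
  shows "coprime (h - 1) m"
proof (rule ccontr)
  note HD = units_subgroupD[OF H]
  assume "\<not> coprime (h - 1) m"
  then have d: "gcd (h - 1) m \<noteq> 1"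
    by (simp add: coprime_iff_gcd_eq_1)
  define d where "d = gcd (h - 1) m"
  have "d > 0"
    using m_gt_one by (simp add: d_def)
  then have "d > 1"
    using d unfolding d_def by linarith
  obtain x where x: "m = d * x"
    unfolding d_def by (meson gcd_dvd2 dvdE)
  have "0 < x"
    using x m_gt_one \<open>d > 0\<close> by (metis zero_less_mult_pos less_trans zero_less_one)
  moreover have "x < m"
    using x \<open>0 < x\<close> \<open>d > 1\<close> by simp
  ultimately have xR: "x \<in> carrier R" "0 \<in> carrier R"
    by (auto simp: res_carrier_eq)
  have "d dvd h - 1"
    by (simp add: d_def)
  then have "m dvd x * (h - 1)"
    using x by (simp add: mult.commute)
  then have "affine_perm m 0 h x = x" "affine_perm m 0 h 0 = 0"
    using xR by (auto simp: affine_perm_fixed_iff)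
  moreover have "\<forall>y\<in>carrier R. \<forall>z\<in>carrier R. y \<noteq> z \<and> affine_perm m 0 h y = y \<and> affine_perm m 0 h z = z \<longrightarrow>
      affine_perm m 0 h = \<one>\<^bsub>BijGroup (carrier R)\<^esub>"
    using frob affine_groupI[OF xR(2) h(1)] by (simp add: frobenius_group_def)
  ultimately have "affine_perm m 0 h = \<one>\<^bsub>BijGroup (carrier R)\<^esub>"
    using xR \<open>0 < x\<close> by (metis less_irrefl)
  moreover have "h \<in> carrier R"
    using HD(2,3)[OF h(1)] by (simp add: res_carrier_eq)
  ultimately show False
    using h(2) xR(2) by (simp add: affine_perm_eq_one_iff)
qed

section \<open>Circulants and arc-transitivity\<close>

lemma circulant_arc_iff:
  "(x, y) \<in> parcs (circulant m S) \<longleftrightarrow> x \<in> carrier R \<and> y \<in> carrier R \<and> (x - y) mod m \<in> S"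
  unfolding circulant_def R_m_def[symmetric]
  by (auto simp: a_minus_def res_neg_eq res_add_eq mod_simps)

text \<open>The neighbours of 0 recover the connection set. This matters because
  \<open>first_kind_frobenius_with\<close> speaks of its \<open>S\<close> only through the
  graph.\<close>

lemma circulant_inject:
  assumes "circulant m S = circulant m T" "S \<subseteq> carrier R" "T \<subseteq> carrier R"
  shows "S = T"
proof -
  have "x \<in> A \<longleftrightarrow> x \<in> carrier R \<and> (x, 0) \<in> parcs (circulant m A)" if "A \<subseteq> carrier R" for x A
    using that m_gt_one by (auto simp: circulant_arc_iff res_carrier_eq subset_iff)
  then show ?thesis
    using assms by (metis subsetI subset_antisym)
qed

text \<open>Affine maps multiply differences by \<open>h\<close>. Arcs are preserved because
  \<open>H\<close> is closed under multiplication by \<open>h\<close>, and reflected because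
  \<open>H\<close> also contains an inverse of \<open>h\<close>.\<close>

lemma arc_transitive_circulant:
  assumes H: "subgroup H (units_of R)"
  shows "arc_transitive (affine_group m H) (circulant m H)"
proof -
  note HD = units_subgroupD[OF H]
  have verts: "pverts (circulant m H) = carrier R"
    unfolding circulant_def R_m_def[symmetric] by simp
  have diff: "(affine_perm m b h x - affine_perm m b h y) mod m = ((x - y) mod m * h) mod m"
    if "x \<in> carrier R" "y \<in> carrier R" for b h x y
    using that by (simp add: affine_perm_apply mod_simps algebra_simps)
  have closed: "affine_perm m b h x \<in> carrier R" if "x \<in> carrier R" for b h x
    using that by (simp add: affine_perm_apply)
  have cancel: "z mod m \<in> H \<longleftrightarrow> (z mod m * h) mod m \<in> H" if h: "h \<in> H" for z h
  proof
    assume "(z mod m * h) mod m \<in> H"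
    moreover obtain k where k: "k \<in> H" "[h * k = 1] (mod m)"
      using HD(6) h by blast
    ultimately have "((z mod m * h) mod m * k) mod m \<in> H"
      using HD(5) by blast
    moreover have "[z * (h * k) = z * 1] (mod m)"
      using k(2) by (rule cong_scalar_left)
    ultimately show "z mod m \<in> H"
      by (simp add: mod_simps cong_def mult.assoc)
  qed (simp add: HD(5) h)
  have transitive: "\<exists>g\<in>affine_group m H. g x = u \<and> g y = v"
    if arcs: "(x, y) \<in> parcs (circulant m H)" "(u, v) \<in> parcs (circulant m H)" for x y u v
  proof -
    have R: "x \<in> carrier R" "y \<in> carrier R" "u \<in> carrier R" "v \<in> carrier R"
      and xy: "(x - y) mod m \<in> H" and uv: "(u - v) mod m \<in> H"
      using arcs by (auto simp: circulant_arc_iff)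
    obtain k where k: "k \<in> H" "[(x - y) mod m * k = 1] (mod m)"
      using HD(6) xy by blast
    \<comment> \<open>Mapping \<open>x - y\<close> to \<open>u - v\<close> forces \<open>h\<close>
      to be their quotient, with \<open>k\<close> inverting \<open>x - y\<close>. Mapping
      \<open>y\<close> to \<open>v\<close> then forces \<open>b\<close>, using the inverse
      \<open>l\<close> of \<open>h\<close>.\<close>
    define h where "h = (k * ((u - v) mod m)) mod m"
    have h: "h \<in> H"
      using HD(5) k(1) uv by (simp add: h_def)
    then obtain l where l: "l \<in> H" "[h * l = 1] (mod m)"
      using HD(6) by blast
    define b where "b = (v * l - y) mod m"
    have "[v * (h * l) = v * 1] (mod m)"
      using l(2) by (rule cong_scalar_left)
    moreover have "[y + b = v * l] (mod m)"
      by (simp add: b_def cong_def mod_simps)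
    then have "[(y + b) * h = v * l * h] (mod m)"
      by (rule cong_scalar_right)
    ultimately have vy: "((y + b) * h) mod m = v mod m"
      by (simp add: cong_def mult_ac)
    have "[(x - y) * k = 1] (mod m)"
      using k(2) by (simp add: cong_def mod_simps)
    then have "[(x - y) * k * (u - v) = 1 * (u - v)] (mod m)"
      by (rule cong_scalar_right)
    then have *: "[(x - y) * h = u - v] (mod m)"
      by (simp add: h_def cong_def mod_simps mult_ac)
    \<comment> \<open>The image of \<open>x\<close> is the image of \<open>y\<close> plus the scaled
      difference.\<close>
    have "[(x - y) * h + (y + b) * h = (u - v) + v] (mod m)"
      using * vy by (intro cong_add) (auto simp: cong_def)
    then have ux: "((x + b) * h) mod m = u mod m"
      by (simp add: cong_def algebra_simps)
    have "affine_perm m b h x = u \<and> affine_perm m b h y = v"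
      using R vy ux by (simp add: affine_perm_apply) (simp add: res_carrier_eq)
    moreover have "affine_perm m b h \<in> affine_group m H"
      using h by (simp add: affine_groupI b_def)
    ultimately show ?thesis
      by blast
  qed
  show ?thesis
    unfolding arc_transitive_def verts
  proof (intro conjI ballI)
    show "subgroup (affine_group m H) (BijGroup (carrier R))"
      by (rule subgroup_affine_group[OF H])
    show "(x, y) \<in> parcs (circulant m H) \<longleftrightarrow> (g x, g y) \<in> parcs (circulant m H)"
      if g: "g \<in> affine_group m H" and xy: "x \<in> carrier R" "y \<in> carrier R" for g x y
    proof -
      obtain b h where "g = affine_perm m b h" "h \<in> H"
        using g by (metis affine_groupE)
      then show ?thesis
        using xy cancel[of h "x - y"] by (simp add: circulant_arc_iff closed diff)
    qed
  qed (use transitive in auto)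
qed

section \<open>Generators of the additive group and of groups of units\<close>

lemma generate_add_one:
  assumes "S \<subseteq> carrier R" "1 \<in> S"
  shows "generate (add_monoid R) S = carrier R"
proof -
  have "int k mod m \<in> generate (add_monoid R) S" for k
  proof (induction k)
    case 0
    then show ?case
      using generate.one[of "add_monoid R" S] by (simp add: res_zero_eq)
  next
    case (Suc k)
    have "1 \<in> generate (add_monoid R) S"
      using assms(2) by (rule generate.incl)
    from generate.eng[OF this Suc] show ?case
      by (simp add: res_add_eq mod_simps)
  qed
  then have "x \<in> generate (add_monoid R) S" if "x \<in> carrier R" for x
    using that by (metis atLeastAtMost_iff nat_0_le res_carrier_eq mod_pos_pos_trivial zle_diff1_eq)
  then show ?thesis
    using group.generate_incl[OF a_group, of S] assms(1) by auto
qed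

text \<open>The group of units is finite, so inverses are themselves natural powers and natural
  exponents exhaust the generated subgroup.\<close>

lemma generate_units:
  assumes "coprime a m"
  shows "generate (units_of R) {a mod m} = {a ^ k mod m | k :: nat. True}"
    and "subgroup (generate (units_of R) {a mod m}) (units_of R)"
proof -
  interpret U: group "units_of R"
    by (rule units_group)
  have u: "a mod m \<in> Units R"
    using assms m_gt_one by simp
  then show "subgroup (generate (units_of R) {a mod m}) (units_of R)"
    by (intro U.generate_is_subgroup) (simp add: units_of_carrier)
  have "(a mod m) [^]\<^bsub>units_of R\<^esub> k = a ^ k mod m" for k :: nat
    using units_of_pow[OF u] pow_cong by simp
  then show "generate (units_of R) {a mod m} = {a ^ k mod m | k :: nat. True}"
    using U.generate_pow_on_finite_carrier[of "a mod m"] u by (simp add: units_of_carrier)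
qed

text \<open>Since \<open>a ^ (2 * p)\<close> is congruent to 1, \<open>k\<close> may be replaced by
  its remainder \<open>r\<close>. For \<open>r < p\<close> the gcd condition with minus applies. For
  \<open>r = p\<close> the value is congruent to \<open>-2\<close>, a unit as \<open>m\<close> is
  odd. For \<open>r > p\<close> it is congruent to \<open>- (a ^ (r - p) + 1)\<close>, and the
  condition with plus applies.\<close>

lemma coprime_power_diff_one:
  assumes m: "odd m" and p: "p > 0" and a: "[a ^ p + 1 = 0] (mod m)"
    and gcd: "\<forall>i\<in>{1..p - 1}. gcd (a ^ i + 1) m = 1 \<and> gcd (a ^ i - 1) m = 1"
    and "k mod (2 * p) \<noteq> 0"
  shows "coprime (a ^ k - 1) m"
proof -
  define r where "r = k mod (2 * p)"
  have r: "0 < r" "r < 2 * p"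
    using p assms(5) by (auto simp: r_def)
  have ap: "[a ^ p = - 1] (mod m)"
    using a by (simp add: cong_iff_dvd_diff)
  have "[(a ^ p) ^ 2 = (- 1) ^ 2] (mod m)"
    using ap by (rule cong_pow)
  then have "[(a ^ (2 * p)) ^ (k div (2 * p)) = 1 ^ (k div (2 * p))] (mod m)"
    by (intro cong_pow) (simp add: power_mult mult.commute)
  then have "[(a ^ (2 * p)) ^ (k div (2 * p)) * a ^ r = 1 * a ^ r] (mod m)"
    by (intro cong_scalar_right) simp
  moreover have "a ^ k = (a ^ (2 * p)) ^ (k div (2 * p)) * a ^ r"
    unfolding r_def by (simp flip: power_mult power_add)
  ultimately have ak: "[a ^ k = a ^ r] (mod m)"
    by simp
  consider "r \<in> {1..p - 1}" | "r = p" | "r - p \<in> {1..p - 1}" "p < r"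
    using r by fastforce
  then have "\<exists>c. [a ^ r - 1 = c] (mod m) \<and> coprime c m"
  proof cases
    case 1
    then have "coprime (a ^ r - 1) m"
      using gcd by (simp only: coprime_iff_gcd_eq_1)
    then show ?thesis
      using cong_refl by blast
  next
    case 2
    have "[a ^ r - 1 = - 1 - 1] (mod m)"
      using ap 2 by (intro cong_diff) auto
    moreover have "coprime (- 1 - 1) m"
      using m by simp
    ultimately show ?thesis
      by blast
  next
    case 3
    have "[a ^ p * a ^ (r - p) - 1 = - 1 * a ^ (r - p) - 1] (mod m)"
      using ap by (intro cong_diff cong_scalar_right) auto
    moreover have "a ^ p * a ^ (r - p) = a ^ r"
      using 3 by (simp flip: power_add)
    moreover have "coprime (a ^ (r - p) + 1) m"
      using gcd 3 by (simp only: coprime_iff_gcd_eq_1)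
    then have "coprime (- (a ^ (r - p) + 1)) m"
      by (simp only: coprime_minus_left_iff)
    ultimately show ?thesis
      by (intro exI[of _ "- (a ^ (r - p) + 1)"]) auto
  qed
  then obtain c where c: "[a ^ r - 1 = c] (mod m)" "coprime c m"
    by blast
  have "[a ^ k - 1 = c] (mod m)"
    using cong_diff[OF ak cong_refl[of 1]] c(1) cong_trans by blast
  then show ?thesis
    using c(2) cong_imp_coprime cong_sym by blast
qed

text \<open>An element \<open>a\<close> of \<open>H\<close> with \<open>a ^ p\<close> congruent to
  \<open>-1\<close>, itself not congruent to \<open>1\<close> or \<open>-1\<close>, has order
  dividing \<open>2 * p\<close> but neither 2 nor \<open>p\<close>; so it generates \<open>H\<close>
  by counting. The gcd conditions are semiregularity at \<open>a ^ i\<close> and at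
  \<open>- (a ^ i)\<close>.\<close>

lemma semiregular_subgroup_cyclic:
  assumes p: "prime p" "odd p"
    and H: "subgroup H (units_of R)" and card: "card H = 2 * p" and neg: "(- 1) mod m \<in> H"
    and semireg: "\<And>h. h \<in> H \<Longrightarrow> h \<noteq> 1 \<Longrightarrow> coprime (h - 1) m"
  shows "\<exists>a > 0. H = generate (units_of R) {a mod m} \<and> [a ^ p + 1 = 0] (mod m) \<and>
           (\<forall>i\<in>{1..p - 1}. gcd (a ^ i + 1) m = 1 \<and> gcd (a ^ i - 1) m = 1)"
proof -
  note HD = units_subgroupD[OF H]
  interpret U: group "units_of R"
    by (rule units_group)
  have H_mod: "h mod m = h" if "h \<in> H" for h
    using HD(2,3)[OF that] by simp
  have one_mod: "1 mod m = 1"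
    using m_gt_one by simp
  \<comment> \<open>Elements of \<open>H\<close> are reduced residues; this form admits arbitrary
    representatives, such as powers and negatives.\<close>
  have semireg': "coprime (z - 1) m" if "z mod m \<in> H" "\<not> [z = 1] (mod m)" for z
  proof -
    have "z mod m \<noteq> 1"
      using that(2) one_mod by (auto simp: cong_def)
    then have "coprime (z mod m - 1) m"
      using semireg that(1) by blast
    moreover have "[z mod m - 1 = z - 1] (mod m)"
      by (simp add: cong_def mod_simps)
    ultimately show ?thesis
      using cong_imp_coprime by blast
  qed
  have neg_closed: "(- z) mod m \<in> H" if "z mod m \<in> H" for z
    using HD(5)[OF that neg] by (simp add: mod_simps)
  have p3: "p \<ge> 3"
    using p prime_ge_2_nat[OF p(1)] by (cases "p = 2") auto
  have "\<not> H \<subseteq> {1, (- 1) mod m}"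
  proof
    assume "H \<subseteq> {1, (- 1) mod m}"
    then have "card H \<le> card {1, (- 1) mod m}"
      by (intro card_mono) auto
    also have "\<dots> \<le> 2"
      by (simp add: card_insert_if)
    finally show False
      using card p3 by simp
  qed
  then obtain h where h: "h \<in> H" "h \<noteq> 1" "h \<noteq> (- 1) mod m"
    by blast
  have h1: "\<not> [h = 1] (mod m)" "\<not> [h = - 1] (mod m)"
    using h H_mod one_mod by (auto simp: cong_def)
  have sq_root: "[z = - 1] (mod m) \<or> [z = 1] (mod m)"
    if "z mod m \<in> H" "[z ^ 2 = 1] (mod m)" for z
  proof (rule disjCI)
    assume "\<not> [z = 1] (mod m)"
    then have "coprime (z - 1) m"
      using semireg' that(1) by blast
    moreover have "m dvd (z - 1) * (z + 1)"
      using that(2) by (simp add: cong_iff_dvd_diff algebra_simps power2_eq_square)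
    ultimately have "m dvd z + 1"
      by (metis coprime_commute coprime_dvd_mult_right_iff)
    then show "[z = - 1] (mod m)"
      by (simp add: cong_iff_dvd_diff)
  qed
  have "[(h ^ p) ^ 2 = 1] (mod m)"
    using units_subgroup_power_card[OF H h(1)] by (simp add: card power_mult mult.commute)
  then have "[h ^ p = 1] (mod m) \<or> [h ^ p = - 1] (mod m)"
    using sq_root[of "h ^ p"] units_subgroup_power[OF H h(1)] by blast
  then have "\<exists>a\<in>H. [a ^ p = - 1] (mod m) \<and> \<not> [a = 1] (mod m) \<and> \<not> [a = - 1] (mod m)"
  proof
    assume hp: "[h ^ p = 1] (mod m)"
    \<comment> \<open>As \<open>p\<close> is odd, passing to the negative turns a
      \<open>p\<close>-th power \<open>1\<close> into \<open>-1\<close>.\<close>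
    let ?a = "(- h) mod m"
    have "[?a ^ p = (- h) ^ p] (mod m)"
      by (intro cong_pow) simp
    also have "(- h) ^ p = - (h ^ p)"
      using p(2) by simp
    also have "[- (h ^ p) = - 1] (mod m)"
      using hp by (simp add: cong_minus_minus_iff)
    finally have "[?a ^ p = - 1] (mod m)" .
    moreover have "?a \<in> H"
      using neg_closed[of h] h(1) H_mod by simp
    moreover have "\<not> [?a = 1] (mod m)" "\<not> [?a = - 1] (mod m)"
      using h1 cong_minus_minus_iff[of h 1 m] cong_minus_minus_iff[of h "-1" m] by auto
    ultimately show ?thesis
      by blast
  qed (use h h1 in blast)
  then obtain a where a: "a \<in> H" "[a ^ p = - 1] (mod m)" "\<not> [a = 1] (mod m)" "\<not> [a = - 1] (mod m)"
    by blast
  \<comment> \<open>Otherwise \<open>m\<close> is at most 2, and the residues strictly between 0 and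
    \<open>m\<close> leave only 1 for \<open>H\<close>.\<close>
  have "\<not> [- 1 = 1] (mod m)"
  proof
    assume "[- 1 = 1] (mod m)"
    then have "m dvd 2"
      by (simp add: cong_iff_dvd_diff)
    then have "m \<le> 2"
      by (auto dest: zdvd_imp_le)
    then have "H \<subseteq> {1}"
      using HD(2,3) by force
    then have "card H \<le> 1"
      by (metis card.empty card_mono finite.emptyI finite_insert is_singletonI is_singleton_altdef)
    then show False
      using card p3 by simp
  qed
  then have ap1: "\<not> [a ^ p = 1] (mod m)"
    using a(2) cong_trans cong_sym by blast
  have a2: "\<not> [a ^ 2 = 1] (mod m)"
    using sq_root[of a] a H_mod by auto
  have aU: "a \<in> carrier (units_of R)" "a \<in> Units R" "coprime a m"
    using HD(2-4)[OF a(1)] by (auto simp: units_of_carrier res_units_eq)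
  have pow: "U.ord a dvd k \<longleftrightarrow> [a ^ k = 1] (mod m)" for k
  proof -
    have "U.ord a dvd k \<longleftrightarrow> a [^]\<^bsub>units_of R\<^esub> k = \<one>\<^bsub>units_of R\<^esub>"
      using U.pow_eq_id[OF aU(1)] by simp
    also have "\<dots> \<longleftrightarrow> a ^ k mod m = 1"
      using units_of_pow[OF aU(2)] pow_cong[of a k] H_mod[OF a(1)] by (simp add: units_of_one res_one_eq)
    finally show ?thesis
      using one_mod by (simp add: cong_def)
  qed
  have "[a ^ card H = 1] (mod m)"
    by (rule units_subgroup_power_card[OF H a(1)])
  then have ord: "U.ord a = 2 * p"
    using a2 ap1 by (intro dvd_twice_prime_eq[OF p(1)]) (auto simp: pow card)
  have "finite H"
    using card p3 by (intro card_ge_0_finite) simp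
  moreover have "generate (units_of R) {a} \<subseteq> H"
    using a(1) H by (intro U.generate_subgroup_incl) auto
  moreover have "card (generate (units_of R) {a}) = card H"
    using U.generate_pow_card[OF aU(1)] ord card by simp
  ultimately have "H = generate (units_of R) {a mod m}"
    using card_subset_eq H_mod[OF a(1)] by metis
  moreover have "[a ^ p + 1 = 0] (mod m)"
    using a(2) by (simp add: cong_iff_dvd_diff)
  moreover have "gcd (a ^ i + 1) m = 1 \<and> gcd (a ^ i - 1) m = 1" if i: "i \<in> {1..p - 1}" for i
  proof -
    \<comment> \<open>The order \<open>2 * p\<close> divides \<open>2 * i\<close> only if
      \<open>p\<close> divides \<open>i\<close>, so \<open>a ^ i\<close> is not a square root of
      1.\<close>
    have "\<not> p dvd i"
      using i by (auto dest: dvd_imp_le)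
    then have "\<not> U.ord a dvd 2 * i"
      unfolding ord by simp
    then have "\<not> [(a ^ i) ^ 2 = 1] (mod m)"
      by (simp add: pow power_mult mult.commute)
    then have ai: "\<not> [a ^ i = 1] (mod m)" "\<not> [a ^ i = - 1] (mod m)"
      by (metis cong_pow one_power2, metis cong_pow power2_minus one_power2)
    have aiH: "a ^ i mod m \<in> H"
      using units_subgroup_power[OF H a(1)] .
    have minus: "coprime (a ^ i - 1) m"
      using semireg' aiH ai(1) by blast
    have "coprime (- (a ^ i) - 1) m"
      using semireg'[OF neg_closed[OF aiH]] ai(2) cong_minus_minus_iff[of "a ^ i" "-1" m] by simp
    moreover have "- (a ^ i) - 1 = - (a ^ i + 1)"
      by simp
    ultimately have "coprime (- (a ^ i + 1)) m"
      by metis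
    then have "coprime (a ^ i + 1) m"
      by (simp only: coprime_minus_left_iff)
    with minus show ?thesis
      by (simp only: coprime_iff_gcd_eq_1)
  qed
  ultimately show ?thesis
    using HD(2)[OF a(1)] by (intro exI[of _ a]) auto
qed

end

section \<open>Frobenius circulants of valency twice an odd prime\<close>

theorem theorem5p3:
  fixes p :: nat and n :: int and S :: "int set"
  assumes "prime p" and "odd p" and "n \<ge> 2 * int p + 1"
    and "circulant_set n S" and "card S = 2 * p" and "1 mod n \<in> S"
  shows
    "(first_kind_frobenius n (circulant n S) \<longleftrightarrow>
        [n = 1] (mod (2 * int p)) \<and>
        (\<exists>a::int. a > 0 \<and> S = generate (units_of (residue_ring n)) {a mod n} \<and>
           [a ^ p + 1 = 0] (mod n) \<and>
           (\<forall>i\<in>{1..p - 1}. gcd (a ^ i + 1) n = 1 \<and> gcd (a ^ i - 1) n = 1)))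
     \<and>
     (\<forall>a::int.
        [n = 1] (mod (2 * int p)) \<and>
        a > 0 \<and> S = generate (units_of (residue_ring n)) {a mod n} \<and>
        [a ^ p + 1 = 0] (mod n) \<and>
        (\<forall>i\<in>{1..p - 1}. gcd (a ^ i + 1) n = 1 \<and> gcd (a ^ i - 1) n = 1) \<longrightarrow>
        (let H = generate (units_of (residue_ring n)) {a mod n} in
           arc_transitive (affine_group n H) (circulant n H) \<and>
           first_kind_frobenius_with n H (circulant n H)))"
proof -
  have n1: "n > 1"
    using assms(1,3) prime_gt_0_nat[of p] by linarith
  interpret residues n "residue_ring n"
    using n1 by unfold_locales simp_all
  have S: "S \<subseteq> carrier (residue_ring n)" and neg_S: "(\<lambda>x. \<ominus>\<^bsub>residue_ring n\<^esub> x) ` S = S"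
    using assms(4) by (auto simp: circulant_set_def)
  have one_S: "1 \<in> S"
    using assms(6) n1 by simp
  have p: "prime p" "odd p" "p > 0" and card: "card S = 2 * p"
    using assms prime_gt_0_nat by auto
  have p3: "p \<ge> 3"
    using p prime_ge_2_nat[OF p(1)] by (cases "p = 2") auto
  have necessary: "[n = 1] (mod (2 * int p)) \<and>
        (\<exists>a::int. a > 0 \<and> S = generate (units_of (residue_ring n)) {a mod n} \<and>
           [a ^ p + 1 = 0] (mod n) \<and>
           (\<forall>i\<in>{1..p - 1}. gcd (a ^ i + 1) n = 1 \<and> gcd (a ^ i - 1) n = 1))"
    if frob: "first_kind_frobenius n (circulant n S)"
  proof -
    obtain H T s where H: "subgroup H (units_of (residue_ring n))"
      and F: "frobenius_group (carrier (residue_ring n)) (affine_group n H)"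
      and s: "s \<in> carrier (residue_ring n)" and T: "T = s <#\<^bsub>residue_ring n\<^esub> H"
      and "circulant_set n T" "circulant n S = circulant n T"
      using frob unfolding first_kind_frobenius_def first_kind_frobenius_with_def by blast
    then have "S = T"
      using circulant_inject S by (auto simp: circulant_set_def)
    then have S_eq: "S = {(s * h) mod n | h. h \<in> H}"
      unfolding T l_coset_def by (auto simp: res_mult_eq)
    note HD = units_subgroupD[OF H]
    \<comment> \<open>From \<open>s * h = 1\<close> with \<open>h\<close> in \<open>H\<close>, the
      element \<open>s\<close> is the inverse \<open>k\<close> of \<open>h\<close> and so lies in
      \<open>H\<close>; the coset of \<open>s\<close> is therefore \<open>H\<close>.\<close>
    obtain h where h: "h \<in> H" "(s * h) mod n = 1"
      using one_S unfolding S_eq by auto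
    obtain k where k: "k \<in> H" "[h * k = 1] (mod n)"
      using HD(6) h(1) by blast
    have "[s * h * k = 1 * k] (mod n)"
      using h(2) n1 by (intro cong_scalar_right) (simp add: cong_def)
    moreover have "[s * (h * k) = s * 1] (mod n)"
      using k(2) by (rule cong_scalar_left)
    ultimately have "[s = k] (mod n)"
      by (metis cong_sym cong_trans mult.assoc mult.left_neutral mult.right_neutral)
    then have "s = k"
      using s HD(2,3)[OF k(1)] by (simp add: cong_def res_carrier_eq)
    then have "S \<subseteq> H"
      using k(1) HD(5) by (auto simp: S_eq)
    moreover have "H \<subseteq> S"
    proof
      fix x assume x: "x \<in> H"
      have "(s * ((h * x) mod n)) mod n = ((s * h) mod n * x) mod n"
        by (simp add: mod_simps mult.assoc)
      then have "(s * ((h * x) mod n)) mod n = x"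
        using h(2) HD(2,3)[OF x] by simp
      then show "x \<in> S"
        unfolding S_eq using HD(5)[OF h(1) x] by (metis (mono_tags, lifting) mem_Collect_eq)
    qed
    ultimately have "S = H" ..
    have semireg: "coprime (x - 1) n" if "x \<in> H" "x \<noteq> 1" for x
      using frobenius_affine_groupD[OF H F that] .
    have "\<ominus>\<^bsub>residue_ring n\<^esub> 1 \<in> S"
      using neg_S one_S by blast
    then have neg: "(- 1) mod n \<in> H"
      by (simp add: res_neg_eq \<open>S = H\<close>)
    obtain a where a: "a > 0" "H = generate (units_of (residue_ring n)) {a mod n}"
      "[a ^ p + 1 = 0] (mod n)"
      "\<forall>i\<in>{1..p - 1}. gcd (a ^ i + 1) n = 1 \<and> gcd (a ^ i - 1) n = 1"
      using semiregular_subgroup_cyclic[OF p(1,2) H _ neg semireg] card \<open>S = H\<close> by blast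
    \<comment> \<open>Semiregularity at \<open>-1\<close> makes \<open>-2\<close> a unit, so
      \<open>n\<close> is odd.\<close>
    have "(- 1) mod n \<noteq> 1"
      using assms(3) p3 by (simp add: zmod_zminus1_eq_if)
    then have "coprime ((- 1) mod n - 1) n"
      using semireg neg by blast
    moreover have "[(- 1) mod n - 1 = - 2] (mod n)"
      by (simp add: cong_def mod_simps)
    ultimately have "coprime (- 2) n"
      using cong_imp_coprime by blast
    then have "odd n"
      by simp
    have "coprime (a - 1) n" "coprime (a + 1) n"
      using a(4) p3 by (auto simp: coprime_iff_gcd_eq_1 dest: bspec[of _ _ 1])
    then have "[n = 1] (mod (2 * int p))"
      using a n1 \<open>odd n\<close> p by (intro cong_1_mod_twice_prime[of p n a]) (auto simp: cong_iff_dvd_diff)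
    then show ?thesis
      using a \<open>S = H\<close> by blast
  qed
  have sufficient: "arc_transitive (affine_group n S) (circulant n S) \<and>
      first_kind_frobenius_with n S (circulant n S)"
    if n: "[n = 1] (mod (2 * int p))" and a: "S = generate (units_of (residue_ring n)) {a mod n}"
      "[a ^ p + 1 = 0] (mod n)"
      "\<forall>i\<in>{1..p - 1}. gcd (a ^ i + 1) n = 1 \<and> gcd (a ^ i - 1) n = 1" for a
  proof -
    \<comment> \<open>The congruence for \<open>n\<close> enters here through oddness, which
      \<open>coprime_power_diff_one\<close> needs for the exponent \<open>p\<close>.\<close>
    have "[n = 1] (mod 2)"
      using n by (rule cong_dvd_modulus) simp
    then have "odd n"
      by (simp add: cong_def odd_iff_mod_2_eq_one)
    \<comment> \<open>Consecutive integers are coprime, so \<open>a ^ p\<close> is coprime to every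
      divisor of \<open>a ^ p + 1\<close>.\<close>
    have "n dvd a ^ p + 1"
      using a(2) by (simp add: cong_iff_dvd_diff)
    then have "coprime (a ^ p) n"
      by (meson coprime_add_one_right coprime_divisors dvd_refl)
    then have cop: "coprime a n"
      using p(3) by simp
    note gen = generate_units[OF cop]
    have H: "subgroup S (units_of (residue_ring n))"
      using gen(2) a(1) by simp
    have semireg: "coprime (h - 1) n" if h: "h \<in> S" "h \<noteq> 1" for h
    proof -
      obtain k where k: "h = a ^ k mod n"
        using h(1) gen(1) a(1) by auto
      have "k mod (2 * p) \<noteq> 0"
      proof
        assume "k mod (2 * p) = 0"
        then obtain q where q: "k = 2 * p * q"
          by auto
        have "[a ^ p = - 1] (mod n)"
          using a(2) by (simp add: cong_iff_dvd_diff)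
        then have "[(a ^ p) ^ (2 * q) = (- 1) ^ (2 * q)] (mod n)"
          by (rule cong_pow)
        then have "[a ^ k = 1] (mod n)"
          by (simp add: q mult_ac flip: power_mult)
        then show False
          using h(2) k n1 by (simp add: cong_def)
      qed
      then have "coprime (a ^ k - 1) n"
        using coprime_power_diff_one[OF \<open>odd n\<close> p(3) a(2,3)] by blast
      moreover have "[a ^ k - 1 = h - 1] (mod n)"
        by (simp add: k cong_def mod_simps)
      ultimately show ?thesis
        using cong_imp_coprime by blast
    qed
    have "S \<noteq> {1}"
      using card p3 by auto
    \<comment> \<open>With coset representative \<open>s = 1\<close>, the set \<open>S\<close>
      itself serves as \<open>H\<close>; \<open>card S = 2 * p\<close> supplies the even
      order.\<close>
    have "h mod n = h" if "h \<in> S" for h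
      using units_subgroupD(2,3)[OF H that] by simp
    then have "S = 1 <#\<^bsub>residue_ring n\<^esub> S"
      by (auto simp: l_coset_def res_mult_eq)
    moreover have "1 \<in> carrier (residue_ring n)"
      using one_S S by blast
    moreover have "generate (add_monoid (residue_ring n)) S = carrier (residue_ring n)"
      using S one_S by (rule generate_add_one)
    ultimately have "first_kind_frobenius_with n S (circulant n S)"
      unfolding first_kind_frobenius_with_def
      using H frobenius_affine_group[OF H \<open>S \<noteq> {1}\<close> semireg]
        frobenius_kernel_affine_group[OF H semireg] assms(4) card
      by (metis dvd_triv_left)
    then show ?thesis
      using arc_transitive_circulant[OF H] by blast
  qed
  show ?thesis
    using necessary sufficient unfolding first_kind_frobenius_def Let_def by blast
qed

end
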